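(* Let $k\ge 1$ be an integer, let $(T_1,r_1),(T_2,r_2),\dots,(T_k,r_k)$ be rooted trees, and let $T$ be their concatenation, of order $n$. Let $\mathbf{m}=(m_1,\dots,m_k)$ with $m_i=|E(T_i)|$ be the size vector, let $\boldsymbol{\mu}=(\mu_1,\dots,\mu_k)$ with $\mu_i=\mu(T_i,r_i)$ be the moment vector, let $X=[x_{ij}]$ be the $k\times k$ matrix with $x_{ij}=|i-j|$, and let $\mathbf{e}\in\mathbb{R}^k$ be the all ones vector. If $T$ is nontrivial, then $$\kappa(T)=\frac{1}{n-1}\left(\sum_{i=1}^k m_i\,\kappa(T_i)+\mathbf{m}^TX(\mathbf{m}+2\mathbf{e})+(n-1)\boldsymbol{\mu}^T\mathbf{e}-\boldsymbol{\mu}^T\mathbf{m}+\frac{k^3}{3}-kn+n+\frac{k}{6}-\frac{1}{2}\right).$$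
   Context: All graphs are finite, simple and undirected. The order of a graph is its number of vertices; a graph is trivial if it has exactly one vertex. A rooted tree $(R,r)$ is a tree $R$ with a distinguished vertex $r\in V(R)$. Its moment is $\mu(R,r)=\sum_{v\in V(R)}\operatorname{dist}(v,r)\deg(v)$, with distance and degree taken in $R$. The concatenation of rooted trees $(T_1,r_1),\dots,(T_k,r_k)$ is the tree obtained by taking the disjoint union of $T_1,\dots,T_k$ and adding the edges $r_1r_2,r_2r_3,\dots,r_{k-1}r_k$. For a connected graph $G$ on vertices $1,\dots,N$ with $N\ge 2$, adjacency matrix $A$ and diagonal degree matrix $D$, consider the random walk on $G$ with transition matrix $D^{-1}A$. Let $\mathbf{w}=(w_j)$ be its unique stationary distribution ($\mathbf{w}^TD^{-1}A=\mathbf{w}^T$, positive entries summing to $1$), and let $m_{ij}$ be the expected value of the smallest $s\geq 1$ such that the walk started at $i$ is at $j$ at time $s$ (so $m_{ii}$ is the mean return time). Kemeny's constant of $G$ is $\kappa(G)=\sum_{j=1}^N m_{ij}w_j-1$, which does not depend on $i$. By convention, Kemeny's constant of the one-vertex tree is $0$. *)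

theory Defs
  imports
    "HOL-Probability.Probability"
    "Graph_Theory.Graph_Theory"
    "Jordan_Normal_Form.Matrix"
begin

unbundle no inner_syntax
no_notation Finite_Cartesian_Product.vec_nth (infixl \<open>$\<close> 90)
hide_const (open) Finite_Cartesian_Product.mat Finite_Cartesian_Product.vec

text \<open>
  Finite simple undirected graphs are the symmetric loop-free digraphs of locale
  \<^locale>\<open>pair_graph\<close>: an undirected edge is represented by its two opposite arcs.
\<close>

definition edges :: "'a pair_pre_digraph \<Rightarrow> 'a set set" where
  "edges G = (\<lambda>(u, v). {u, v}) ` parcs G"

definition deg :: "'a pair_pre_digraph \<Rightarrow> 'a \<Rightarrow> nat" where
  "deg G v = out_degree (with_proj G) v"

definition gdist :: "'a pair_pre_digraph \<Rightarrow> 'a \<Rightarrow> 'a \<Rightarrow> nat" where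
  "gdist G u v = (LEAST l. \<exists>p. pre_digraph.awalk (with_proj G) u p v \<and> length p = l)"

text \<open>
  The constant \<^const>\<open>tree\<close> of the graph library is not usable for this representation: traversing
  an undirected edge back and forth is a \<^const>\<open>pre_digraph.cycle\<close> of length 2.
  The cycles of the undirected graph are those of length at least 3.
\<close>

definition graph_tree :: "'a pair_pre_digraph \<Rightarrow> bool" where
  "graph_tree G \<longleftrightarrow>
     pair_graph G \<and> Digraph_Component.connected (with_proj G) \<and>
     \<not> (\<exists>p. pre_digraph.cycle (with_proj G) p \<and> 3 \<le> length p)"

definition rooted_tree :: "'a pair_pre_digraph \<Rightarrow> 'a \<Rightarrow> bool" where
  "rooted_tree R r \<longleftrightarrow> graph_tree R \<and> r \<in> pverts R"

definition moment :: "'a pair_pre_digraph \<Rightarrow> 'a \<Rightarrow> nat" where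
  "moment R r = (\<Sum>v\<in>pverts R. gdist R v r * deg R v)"

text \<open>
  The trees are indexed by \<open>0, \<dots>, k - 1\<close>; tagging each vertex with the index of its tree makes
  the union disjoint.
\<close>

definition concatenation ::
    "nat \<Rightarrow> (nat \<Rightarrow> 'a pair_pre_digraph) \<Rightarrow> (nat \<Rightarrow> 'a) \<Rightarrow> (nat \<times> 'a) pair_pre_digraph" where
  "concatenation k T r =
     \<lparr> pverts = (SIGMA i:{..<k}. pverts (T i)),
       parcs = {((i, u), (i, v)) | i u v. i < k \<and> (u, v) \<in> parcs (T i)}
             \<union> {((i, r i), (Suc i, r (Suc i))) | i. Suc i < k}
             \<union> {((Suc i, r (Suc i)), (i, r i)) | i. Suc i < k} \<rparr>"

definition adjacency :: "'a pair_pre_digraph \<Rightarrow> 'a \<Rightarrow> 'a \<Rightarrow> real" where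
  "adjacency G u v = (if (u, v) \<in> parcs G then 1 else 0)"

text \<open>Entry \<open>(u, v)\<close> of \<open>D\<^sup>-\<^sup>1A\<close>.\<close>

definition transition :: "'a pair_pre_digraph \<Rightarrow> 'a \<Rightarrow> 'a \<Rightarrow> real" where
  "transition G u v = adjacency G u v / real (deg G u)"

text \<open>
  Setting the function to \<open>0\<close> outside the vertex set is what makes it unique as a
  function on the whole type.
\<close>

definition stationary :: "'a pair_pre_digraph \<Rightarrow> 'a \<Rightarrow> real" where
  "stationary G = (THE w.
     (\<forall>j\<in>pverts G. 0 < w j) \<and> (\<forall>j. j \<notin> pverts G \<longrightarrow> w j = 0) \<and>
     (\<Sum>j\<in>pverts G. w j) = 1 \<and>
     (\<forall>j\<in>pverts G. (\<Sum>i\<in>pverts G. w i * transition G i j) = w j))"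

text \<open>
  The law of the trajectory \<open>\<omega> 0, \<omega> 1, \<dots>\<close> of the walk started at \<open>i\<close>, as the Ionescu-Tulcea
  limit: \<open>walk_kernel G i t \<omega>\<close> is the conditional law of \<open>\<omega> t\<close> given \<open>\<omega> 0, \<dots>, \<omega> (t - 1)\<close>.
\<close>

primrec walk_kernel :: "'a pair_pre_digraph \<Rightarrow> 'a \<Rightarrow> nat \<Rightarrow> (nat \<Rightarrow> 'a) \<Rightarrow> 'a measure" where
  "walk_kernel G i 0 \<omega> = measure_pmf (return_pmf i)"
| "walk_kernel G i (Suc t) \<omega> = measure_pmf (embed_pmf (transition G (\<omega> t)))"

lemma Ionescu_Tulcea_walk_kernel:
  "Ionescu_Tulcea (walk_kernel G i) (\<lambda>_. count_space UNIV)"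
proof (rule Ionescu_Tulcea.intro)
  fix t :: nat
  show "walk_kernel G i t
          \<in> (PiM {0..<t} (\<lambda>_. count_space UNIV)) \<rightarrow>\<^sub>M subprob_algebra (count_space UNIV)"
  proof (cases t)
    case 0
    then show ?thesis
      by (auto intro!: measurable_const simp: space_subprob_algebra measure_pmf.subprob_space_axioms
          cong: measurable_cong)
  next
    case (Suc s)
    have "(\<lambda>\<omega>. measure_pmf (embed_pmf (transition G (\<omega> s))))
        \<in> (PiM {0..<t} (\<lambda>_. count_space UNIV)) \<rightarrow>\<^sub>M subprob_algebra (count_space UNIV)"
    proof (rule measurable_compose[where f = "\<lambda>\<omega>. \<omega> s" and N = "count_space UNIV"
          and g = "\<lambda>x. measure_pmf (embed_pmf (transition G x))"])
      show "(\<lambda>\<omega>. \<omega> s) \<in> (PiM {0..<t} (\<lambda>_. count_space UNIV)) \<rightarrow>\<^sub>M count_space UNIV"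
        using Suc measurable_component_singleton[of s "{0..<t}" "\<lambda>_. count_space UNIV"] by simp
      show "(\<lambda>x. measure_pmf (embed_pmf (transition G x)))
          \<in> count_space UNIV \<rightarrow>\<^sub>M subprob_algebra (count_space UNIV)"
        by (auto simp: space_subprob_algebra measure_pmf.subprob_space_axioms)
    qed
    then show ?thesis
      using Suc by (simp add: walk_kernel.simps(2)[abs_def] cong: measurable_cong)
  qed
next
  fix t :: nat and \<omega> :: "nat \<Rightarrow> 'a"
  show "prob_space (walk_kernel G i t \<omega>)"
    by (cases t) (auto simp: measure_pmf.prob_space_axioms)
qed

definition random_walk :: "'a pair_pre_digraph \<Rightarrow> 'a \<Rightarrow> (nat \<Rightarrow> 'a) measure" where
  "random_walk G i =
     projective_family.lim UNIV
       (Ionescu_Tulcea.CI (walk_kernel G i) (\<lambda>_. count_space UNIV)) (\<lambda>_. count_space UNIV)"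

text \<open>The infimum is \<open>\<infinity>\<close> on trajectories that never visit \<open>j\<close>.\<close>

definition passage_time :: "'a \<Rightarrow> (nat \<Rightarrow> 'a) \<Rightarrow> ennreal" where
  "passage_time j \<omega> = (INF s\<in>{s. 1 \<le> s \<and> \<omega> s = j}. of_nat s)"

definition mean_passage_time :: "'a pair_pre_digraph \<Rightarrow> 'a \<Rightarrow> 'a \<Rightarrow> real" where
  "mean_passage_time G i j = enn2real (\<integral>\<^sup>+\<omega>. passage_time j \<omega> \<partial>random_walk G i)"

text \<open>For connected graphs the defining sum is the same for every starting vertex \<open>i\<close>.\<close>

definition kemeny :: "'a pair_pre_digraph \<Rightarrow> real" where
  "kemeny G =
     (if card (pverts G) = 1 then 0
      else (THE c. \<forall>i\<in>pverts G.
              (\<Sum>j\<in>pverts G. mean_passage_time G i j * stationary G j) - 1 = c))"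

end

theory Submission
  imports Defs
begin

text \<open>
  Let \<open>D\<close> be the distance in a tree. A vertex \<open>u \<noteq> z\<close> has exactly one neighbour closer to \<open>z\<close> and all
  others are farther away, so \<open>(\<Sum>v. D v z - D u z)\<close>, summed over the neighbours \<open>v\<close> of \<open>u\<close>, equals
  \<open>deg u - 2\<close>, plus \<open>2\<close> if \<open>u = z\<close>. This one identity (locale \<open>tree_metric\<close>) carries the whole proof.

  It solves the random walk: harmonic functions are constant (\<open>harmonic_imp_constant\<close>), the stationary
  distribution is proportional to the degrees, and the expected time to reach \<open>j\<close> from \<open>i\<close> is
  \<open>\<Sum>z. deg z * (D i j + D j z - D i z) / 2\<close> (\<open>survival_sums_passage\<close>). Averaging over \<open>j\<close> gives
  \<open>4 * \<bar>E\<bar> * \<kappa> = \<Sum>j. \<Sum>z. deg j * deg z * D j z\<close> (\<open>kemeny_eq\<close>), which also covers the one-vertex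
  tree. The passage from trajectories to these equations is the tail-sum formula for the passage time
  together with the finite-dimensional laws of the walk (\<open>nn_integral_passage_time\<close>).

  The identity is inherited by a concatenation if the distance between vertices of different trees
  \<open>i\<close> and \<open>j\<close> is taken to be the distances to the two roots plus \<open>\<bar>i - j\<bar>\<close> (\<open>tree_metric_chain\<close>). Hence
  the formula for \<open>\<kappa>\<close> applies to the concatenation with this explicit distance, and its double sum
  splits into blocks indexed by pairs of trees (\<open>block_sum\<close>). Let \<open>c i\<close> be the degree of \<open>i\<close> in the
  path \<open>0, \<dots>, k - 1\<close> and \<open>a i = 2 * m i + c i\<close> the degree sum of the \<open>i\<close>-th tree inside the
  concatenation. Adding up the blocks yields
  \<open>(n - 1) * \<kappa> = (\<Sum>i. m i * \<kappa> (T i)) - (\<Sum>i. m i * \<mu> i) + (n - 1) * (\<Sum>i. \<mu> i) + (a \<bullet> X a) / 4\<close>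
  (\<open>kemeny_C\<close>). The remaining terms of the stated formula are the value of \<open>(a \<bullet> X a) / 4\<close>, where \<open>c\<close>
  is constant \<open>2\<close> except for the two ends of the path (\<open>path_quadratic_form\<close>).
\<close>

section \<open>The law of the passage time\<close>

text \<open>
  The transition operator killed at \<open>j\<close>: its powers applied to \<open>1\<close> are the probabilities that the
  walk has not yet reached \<open>j\<close>. It is defined on the whole type through the probability mass
  functions from which the walk is built; on the vertex set it is a finite sum.
\<close>

definition taboo_step :: "'a pair_pre_digraph \<Rightarrow> 'a \<Rightarrow> ('a \<Rightarrow> ennreal) \<Rightarrow> 'a \<Rightarrow> ennreal" where
  "taboo_step G j g x = (\<integral>\<^sup>+y. (if y = j then 0 else g y) \<partial>measure_pmf (embed_pmf (transition G x)))"

text \<open>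
  Events that depend on finitely many steps can be computed in the finite stage of the
  Ionescu-Tulcea construction, where integrals unfold step by step.
\<close>

lemma nn_integral_random_walk:
  fixes f :: "(nat \<Rightarrow> 'a) \<Rightarrow> ennreal"
  assumes f: "f \<in> borel_measurable (PiM {0..<n} (\<lambda>_. count_space UNIV))"
  shows "(\<integral>\<^sup>+\<omega>. f (restrict \<omega> {0..<n}) \<partial>random_walk G i) =
    (\<integral>\<^sup>+\<omega>. f \<omega> \<partial>Ionescu_Tulcea.C (walk_kernel G i) (\<lambda>_. count_space UNIV) 0 n (\<lambda>_. undefined))"
proof -
  interpret Ionescu_Tulcea "walk_kernel G i" "\<lambda>_. count_space UNIV"
    by (rule Ionescu_Tulcea_walk_kernel)
  let ?M = "PiM {0..<n} (\<lambda>_. count_space UNIV) :: (nat \<Rightarrow> 'a) measure"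
  note measurable_cong_sets[OF sets_C, simp]
  have [simp]: "up_to {0..<n} = n"
  proof (rule antisym)
    show "up_to {0..<n} \<le> n" by (simp add: up_to_iff)
    show "n \<le> up_to {0..<n}"
      using up_to_less[of "{0..<n}" "n - 1"] by (cases n) auto
  qed
  have "(\<integral>\<^sup>+\<omega>. f (restrict \<omega> {0..<n}) \<partial>PF.lim) =
      (\<integral>\<^sup>+\<omega>. f \<omega> \<partial>distr PF.lim ?M (\<lambda>\<omega>. restrict \<omega> {0..<n}))"
    using f by (subst nn_integral_distr)
      (auto simp: measurable_cong_sets[OF PF.sets_lim refl] intro!: measurable_restrict measurable_component_singleton)
  also have "\<dots> = (\<integral>\<^sup>+\<omega>. f \<omega> \<partial>CI {0..<n})"
    by (subst distr_lim) auto
  also have "\<dots> = (\<integral>\<^sup>+\<omega>. f (restrict \<omega> {0..<n}) \<partial>C 0 n (\<lambda>_. undefined))"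
    using f unfolding CI_def by (subst nn_integral_distr)
      (auto intro!: measurable_restrict measurable_component_singleton)
  also have "\<dots> = (\<integral>\<^sup>+\<omega>. f \<omega> \<partial>C 0 n (\<lambda>_. undefined))"
    by (intro nn_integral_cong) (auto simp: space_C space_PiM)
  finally show ?thesis by (simp add: random_walk_def)
qed

text \<open>
  The terminal weight \<open>g\<close> is what makes the induction work: the finite stages grow at the end of the
  trajectory, so integrating out the last step replaces \<open>g\<close> by its image under the killed operator.
\<close>

lemma nn_integral_avoiding:
  fixes g :: "'a \<Rightarrow> ennreal"
  shows "(\<integral>\<^sup>+\<omega>. (if \<forall>t\<in>{1..s}. \<omega> t \<noteq> j then g (\<omega> s) else 0)
      \<partial>Ionescu_Tulcea.C (walk_kernel G i) (\<lambda>_. count_space UNIV) 0 (Suc s) (\<lambda>_. undefined)) =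
    (taboo_step G j ^^ s) g i"
proof (induction s arbitrary: g)
  interpret Ionescu_Tulcea "walk_kernel G i" "\<lambda>_. count_space UNIV"
    by (rule Ionescu_Tulcea_walk_kernel)
  have meas: "(\<lambda>\<omega>. if \<forall>t\<in>{1..s}. \<omega> t \<noteq> j then g (\<omega> s) else 0)
      \<in> borel_measurable (PiM {0..<Suc s} (\<lambda>_. count_space UNIV))" for s and g :: "'a \<Rightarrow> ennreal"
  proof (intro measurable_If)
    show "(\<lambda>\<omega>. g (\<omega> s)) \<in> borel_measurable (PiM {0..<Suc s} (\<lambda>_. count_space UNIV))"
      by (rule measurable_compose[OF measurable_component_singleton]) auto
    show "{\<omega> \<in> space (PiM {0..<Suc s} (\<lambda>_. count_space UNIV)). \<forall>t\<in>{1..s}. \<omega> t \<noteq> j}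
        \<in> sets (PiM {0..<Suc s} (\<lambda>_. count_space UNIV))"
    proof (intro sets.sets_Collect_finite_All)
      fix t assume "t \<in> {1..s}"
      then have "(\<lambda>\<omega>. \<omega> t) \<in> PiM {0..<Suc s} (\<lambda>_. count_space UNIV) \<rightarrow>\<^sub>M count_space UNIV"
        by (intro measurable_component_singleton) auto
      from measurable_sets[OF this, of "- {j}"]
      show "{\<omega> \<in> space (PiM {0..<Suc s} (\<lambda>_. count_space UNIV)). \<omega> t \<noteq> j}
          \<in> sets (PiM {0..<Suc s} (\<lambda>_. count_space UNIV))"
        by (simp add: vimage_def Int_def conj_commute)
    qed simp
  qed simp
  have integral_if: "(\<integral>\<^sup>+y. (if P then f y else 0) \<partial>M) = (if P then \<integral>\<^sup>+y. f y \<partial>M else 0)"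
    for P and f :: "'a \<Rightarrow> ennreal" and M
    by simp
  note measurable_cong_sets[OF sets_C, simp]
  {
    case 0
    show ?case
      using meas[of 0 g]
      by (simp add: bind_return[OF measurable_eP[of 0, simplified]] nn_integral_eP space_PiM)
  next
    case (Suc s)
    have "(\<integral>\<^sup>+\<omega>. (if \<forall>t\<in>{1..Suc s}. \<omega> t \<noteq> j then g (\<omega> (Suc s)) else 0)
        \<partial>C 0 (Suc (Suc s)) (\<lambda>_. undefined)) =
      (\<integral>\<^sup>+\<omega>. (\<integral>\<^sup>+\<omega>'. (if \<forall>t\<in>{1..Suc s}. \<omega>' t \<noteq> j then g (\<omega>' (Suc s)) else 0)
        \<partial>eP (Suc s) \<omega>) \<partial>C 0 (Suc s) (\<lambda>_. undefined))"
      using meas[of "Suc s" g] measurable_eP[of "Suc s"]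
      by (subst C.simps, subst nn_integral_bind[where B="PiM {0..<Suc (Suc s)} (\<lambda>_. count_space UNIV)"])
         (auto simp del: C.simps)
    also have "\<dots> = (\<integral>\<^sup>+\<omega>. (if \<forall>t\<in>{1..s}. \<omega> t \<noteq> j then taboo_step G j g (\<omega> s) else 0)
        \<partial>C 0 (Suc s) (\<lambda>_. undefined))"
    proof (rule nn_integral_cong)
      fix \<omega> assume "\<omega> \<in> space (C 0 (Suc s) (\<lambda>_. undefined))"
      then have \<omega>: "\<omega> \<in> space (PiM {0..<Suc s} (\<lambda>_. count_space UNIV))"
        by (subst (asm) space_C) auto
      have "(\<integral>\<^sup>+\<omega>'. (if \<forall>t\<in>{1..Suc s}. \<omega>' t \<noteq> j then g (\<omega>' (Suc s)) else 0) \<partial>eP (Suc s) \<omega>) =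
        (\<integral>\<^sup>+y. (if \<forall>t\<in>{1..s}. \<omega> t \<noteq> j then (if y = j then 0 else g y) else 0)
          \<partial>embed_pmf (transition G (\<omega> s)))"
        by (subst nn_integral_eP[OF \<omega> meas])
           (auto intro!: nn_integral_cong simp: atLeastAtMostSuc_conv)
      then show "(\<integral>\<^sup>+\<omega>'. (if \<forall>t\<in>{1..Suc s}. \<omega>' t \<noteq> j then g (\<omega>' (Suc s)) else 0) \<partial>eP (Suc s) \<omega>) =
        (if \<forall>t\<in>{1..s}. \<omega> t \<noteq> j then taboo_step G j g (\<omega> s) else 0)"
        by (simp only: integral_if taboo_step_def)
    qed
    also have "\<dots> = (taboo_step G j ^^ s) (taboo_step G j g) i"
      by (rule Suc.IH)
    finally show ?case by (simp only: funpow_swap1 funpow.simps o_apply)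
  }
qed

text \<open>
  The tail-sum formula, pointwise: a passage time counts the times \<open>s\<close> that it exceeds. The first
  summand is always \<open>1\<close> because visits at time \<open>0\<close> do not count.
\<close>

lemma passage_time_eq_suminf:
  "passage_time j \<omega> = (\<Sum>s. if \<forall>t\<in>{1..s}. \<omega> t \<noteq> j then 1 else 0)"
proof (cases "\<exists>t\<ge>1. \<omega> t = j")
  case False
  then have "(\<Sum>s. if \<forall>t\<in>{1..s}. \<omega> t \<noteq> j then 1 else (0::ennreal)) = (\<Sum>s. 1)"
    by (intro suminf_cong) auto
  moreover have "{s. 1 \<le> s \<and> \<omega> s = j} = {}" using False by auto
  moreover have "(\<Sum>s::nat. 1 :: ennreal) = \<infinity>"
    using nn_integral_count_space_nat[of "\<lambda>_. 1"] by simp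
  ultimately show ?thesis by (simp add: passage_time_def)
next
  case True
  define \<tau> where "\<tau> = (LEAST t. 1 \<le> t \<and> \<omega> t = j)"
  have \<tau>: "1 \<le> \<tau>" "\<omega> \<tau> = j"
    using LeastI_ex[of "\<lambda>t. 1 \<le> t \<and> \<omega> t = j"] True unfolding \<tau>_def by auto
  have least: "\<tau> \<le> t" if "1 \<le> t" "\<omega> t = j" for t
    unfolding \<tau>_def by (rule Least_le) (use that in auto)
  have "passage_time j \<omega> = of_nat \<tau>"
    unfolding passage_time_def using \<tau> least
    by (intro antisym INF_lower INF_greatest) auto
  moreover have "(\<forall>t\<in>{1..s}. \<omega> t \<noteq> j) \<longleftrightarrow> s < \<tau>" for s
    using \<tau> by (metis atLeastAtMost_iff least le_trans not_le)
  moreover have "(\<Sum>s. if s < \<tau> then 1 else (0::ennreal)) = (\<Sum>s<\<tau>. 1)"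
    by (subst suminf_finite[of "{..<\<tau>}"]) auto
  ultimately show ?thesis by simp
qed

lemma nn_integral_passage_time:
  "(\<integral>\<^sup>+\<omega>. passage_time j \<omega> \<partial>random_walk G i) = (\<Sum>s. (taboo_step G j ^^ s) (\<lambda>_. 1) i)"
proof -
  interpret Ionescu_Tulcea "walk_kernel G i" "\<lambda>_. count_space UNIV"
    by (rule Ionescu_Tulcea_walk_kernel)
  have avoid: "Measurable.pred (PiM I (\<lambda>_. count_space UNIV)) (\<lambda>\<omega>. \<forall>t\<in>{1..s}. \<omega> t \<noteq> j)"
    if "{1..s} \<subseteq> I" for s :: nat and I
  proof (intro pred_intros_finite)
    fix t assume "t \<in> {1..s}"
    with that have "(\<lambda>\<omega>. \<omega> t) \<in> PiM I (\<lambda>_. count_space UNIV) \<rightarrow>\<^sub>M count_space UNIV"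
      by (intro measurable_component_singleton) auto
    then show "Measurable.pred (PiM I (\<lambda>_. count_space UNIV)) (\<lambda>\<omega>. \<omega> t \<noteq> j)"
      by measurable
  qed simp
  have sets: "sets (random_walk G i) = sets (PiM UNIV (\<lambda>_. count_space UNIV))"
    by (simp add: random_walk_def)
  have "(\<integral>\<^sup>+\<omega>. passage_time j \<omega> \<partial>random_walk G i) =
      (\<Sum>s. \<integral>\<^sup>+\<omega>. (if \<forall>t\<in>{1..s}. \<omega> t \<noteq> j then 1 else 0) \<partial>random_walk G i)"
    unfolding passage_time_eq_suminf
    by (intro nn_integral_suminf, subst measurable_cong_sets[OF sets refl])
       (auto intro!: measurable_If avoid)
  also have "\<dots> = (\<Sum>s. (taboo_step G j ^^ s) (\<lambda>_. 1) i)"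
  proof (rule suminf_cong)
    fix s
    have "(\<integral>\<^sup>+\<omega>. (if \<forall>t\<in>{1..s}. \<omega> t \<noteq> j then 1 else 0) \<partial>random_walk G i) =
      (\<integral>\<^sup>+\<omega>. (if \<forall>t\<in>{1..s}. restrict \<omega> {0..<Suc s} t \<noteq> j then 1 else 0) \<partial>random_walk G i)"
      by (intro nn_integral_cong) auto
    also have "\<dots> = (taboo_step G j ^^ s) (\<lambda>_. 1) i"
      by (rule trans[OF nn_integral_random_walk nn_integral_avoiding])
         (auto intro!: measurable_If avoid)
    finally show "(\<integral>\<^sup>+\<omega>. (if \<forall>t\<in>{1..s}. \<omega> t \<noteq> j then 1 else 0) \<partial>random_walk G i) =
      (taboo_step G j ^^ s) (\<lambda>_. 1) i" .
  qed
  finally show ?thesis .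
qed

section \<open>Laplacian and tree metrics\<close>

text \<open>
  The sign is that of the generator of the walk: \<open>laplacian G f u\<close> is the degree of \<open>u\<close> times the
  expected increment of \<open>f\<close> in one step from \<open>u\<close>.
\<close>

definition laplacian :: "'a pair_pre_digraph \<Rightarrow> ('a \<Rightarrow> real) \<Rightarrow> 'a \<Rightarrow> real" where
  "laplacian G f u = (\<Sum>v\<in>parcs G `` {u}. f v - f u)"

lemma deg_eq: "deg G u = card (parcs G `` {u})"
proof -
  have "out_arcs (with_proj G) u = Pair u ` (parcs G `` {u})"
    by (auto simp: out_arcs_def)
  then show ?thesis
    by (simp add: deg_def out_degree_def card_image inj_on_def)
qed

text \<open>
  In a tree, every vertex \<open>u \<noteq> z\<close> has one neighbour that is one step closer to \<open>z\<close>, and all its other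
  neighbours are one step farther away; at \<open>u = z\<close> all neighbours are at distance \<open>1\<close>. The last
  assumption records this as a single equation. It suffices to solve the random walk, and, unlike the
  absence of cycles, it is easy to verify for a concatenation.
\<close>

locale tree_metric =
  fixes G :: "'a pair_pre_digraph" and D :: "'a \<Rightarrow> 'a \<Rightarrow> real"
  assumes finite_verts: "finite (pverts G)"
    and arcs_in_verts: "parcs G \<subseteq> pverts G \<times> pverts G"
    and arcs_sym: "(u, v) \<in> parcs G \<Longrightarrow> (v, u) \<in> parcs G"
    and D_self: "u \<in> pverts G \<Longrightarrow> D u u = 0"
    and D_commute: "u \<in> pverts G \<Longrightarrow> v \<in> pverts G \<Longrightarrow> D u v = D v u"
    and D_triangle: "u \<in> pverts G \<Longrightarrow> v \<in> pverts G \<Longrightarrow> w \<in> pverts G \<Longrightarrow> D u w \<le> D u v + D v w"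
    and laplacian_D: "u \<in> pverts G \<Longrightarrow> z \<in> pverts G \<Longrightarrow>
      laplacian G (\<lambda>v. D v z) u = real (deg G u) - 2 + (if u = z then 2 else 0)"
begin

abbreviation d :: "'a \<Rightarrow> real" where "d u \<equiv> real (deg G u)"

lemma nbrs_subset: "parcs G `` {u} \<subseteq> pverts G"
  using arcs_in_verts by auto

lemma finite_nbrs: "finite (parcs G `` {u})"
  using finite_verts nbrs_subset by (rule rev_finite_subset)

lemma laplacian_alt: "laplacian G f u = (\<Sum>v\<in>parcs G `` {u}. f v) - real (deg G u) * f u"
  by (simp add: laplacian_def sum_subtractf deg_eq)

lemma sum_nbrs_eq:
  "(\<Sum>v\<in>parcs G `` {u}. h v) = (\<Sum>v\<in>pverts G. if (u, v) \<in> parcs G then h v else 0)"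
  for h :: "'a \<Rightarrow> real"
  using nbrs_subset[of u] finite_verts
  by (subst sum.inter_filter[symmetric]) (auto intro!: sum.cong)

lemma sum_nbrs_swap:
  "(\<Sum>u\<in>pverts G. \<Sum>v\<in>parcs G `` {u}. h u v) = (\<Sum>v\<in>pverts G. \<Sum>u\<in>parcs G `` {v}. h u v)"
  for h :: "'a \<Rightarrow> 'a \<Rightarrow> real"
proof -
  have "(\<Sum>u\<in>pverts G. \<Sum>v\<in>parcs G `` {u}. h u v) =
      (\<Sum>v\<in>pverts G. \<Sum>u\<in>pverts G. if (u, v) \<in> parcs G then h u v else 0)"
    unfolding sum_nbrs_eq by (rule sum.swap)
  also have "\<dots> = (\<Sum>v\<in>pverts G. \<Sum>u\<in>parcs G `` {v}. h u v)"
    unfolding sum_nbrs_eq by (intro sum.cong) (auto intro: arcs_sym)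
  finally show ?thesis .
qed

lemma laplacian_selfadjoint:
  "(\<Sum>u\<in>pverts G. g u * laplacian G f u) = (\<Sum>u\<in>pverts G. laplacian G g u * f u)"
proof -
  have "(\<Sum>u\<in>pverts G. g u * laplacian G f u) =
      (\<Sum>u\<in>pverts G. \<Sum>v\<in>parcs G `` {u}. g u * f v) - (\<Sum>u\<in>pverts G. d u * g u * f u)"
    by (simp add: laplacian_alt right_diff_distrib sum_subtractf sum_distrib_left ac_simps)
  also have "\<dots> = (\<Sum>u\<in>pverts G. laplacian G g u * f u)"
    by (subst sum_nbrs_swap)
       (simp add: laplacian_alt left_diff_distrib sum_subtractf sum_distrib_right)
  finally show ?thesis .
qed

lemma sum_laplacian: "(\<Sum>u\<in>pverts G. laplacian G f u) = 0"
  using laplacian_selfadjoint[of "\<lambda>_. 1" f] by (simp add: laplacian_def)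

text \<open>
  Pairing a harmonic function \<open>g\<close> with \<open>D\<close> against a vertex \<open>z\<close> and using self-adjointness gives
  \<open>0 = (\<Sum>u. g u * (deg u - 2)) + 2 * g z\<close>, so \<open>g z\<close> does not depend on \<open>z\<close>. This replaces the maximum
  principle and takes the place of connectedness.
\<close>

lemma harmonic_imp_constant:
  assumes "\<And>u. u \<in> pverts G \<Longrightarrow> laplacian G g u = 0" "x \<in> pverts G" "y \<in> pverts G"
  shows "g x = g y"
proof -
  have "2 * g z = - (\<Sum>u\<in>pverts G. g u * (real (deg G u) - 2))" if z: "z \<in> pverts G" for z
  proof -
    have "0 = (\<Sum>u\<in>pverts G. laplacian G g u * D u z)"
      using assms(1) by simp
    also have "\<dots> = (\<Sum>u\<in>pverts G. g u * laplacian G (\<lambda>v. D v z) u)"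
      by (rule laplacian_selfadjoint[symmetric])
    also have "\<dots> = (\<Sum>u\<in>pverts G. g u * (real (deg G u) - 2) + (if u = z then 2 * g u else 0))"
      by (intro sum.cong) (auto simp: laplacian_D z algebra_simps)
    also have "\<dots> = (\<Sum>u\<in>pverts G. g u * (real (deg G u) - 2)) + 2 * g z"
      using z finite_verts by (simp add: sum.distrib)
    finally show ?thesis by simp
  qed
  from this[OF assms(2)] this[OF assms(3)] show ?thesis by simp
qed

definition vol :: real where "vol = (\<Sum>u\<in>pverts G. d u)"

text \<open>
  Summing the distance identity over all vertices: the sum of a Laplacian vanishes. As \<open>vol\<close> is
  twice the number of edges, a tree has one edge less than vertices.
\<close>

lemma vol_eq:
  assumes "pverts G \<noteq> {}"
  shows "vol = 2 * (real (card (pverts G)) - 1)"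
proof -
  from assms obtain z where z: "z \<in> pverts G" by auto
  have "0 = (\<Sum>u\<in>pverts G. d u - 2 + (if u = z then 2 else 0))"
    using sum_laplacian[of "\<lambda>v. D v z"] z by (simp add: laplacian_D)
  also have "\<dots> = vol - 2 * real (card (pverts G)) + 2"
    using z finite_verts by (simp add: vol_def sum.distrib sum_subtractf)
  finally show ?thesis by simp
qed

text \<open>
  At a vertex without neighbours the Laplacian of the distance vanishes, and the distance identity
  then leaves no room for a second vertex.
\<close>

lemma deg_pos:
  assumes "card (pverts G) > 1" "u \<in> pverts G"
  shows "d u > 0"
proof (rule ccontr)
  assume "\<not> d u > 0"
  then have "parcs G `` {u} = {}"
    using finite_nbrs[of u] by (simp add: deg_eq)
  then have "u = z" if "z \<in> pverts G" for z
    using laplacian_D[OF assms(2) that] by (auto simp: laplacian_def deg_eq split: if_splits)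
  with assms(2) have "pverts G = {u}" by blast
  with assms(1) show False by simp
qed

lemma vol_pos: "card (pverts G) > 1 \<Longrightarrow> vol > 0"
  by (subst vol_eq) auto


section \<open>Stationary distribution, hitting times and Kemeny's constant\<close>

lemma sum_transition:
  "(\<Sum>v\<in>pverts G. transition G u v * f v) = (\<Sum>v\<in>parcs G `` {u}. f v) / d u"
proof -
  have "(\<Sum>v\<in>pverts G. transition G u v * f v) = (\<Sum>v\<in>pverts G. if (u, v) \<in> parcs G then f v / d u else 0)"
    by (intro sum.cong) (auto simp: transition_def adjacency_def)
  also have "\<dots> = (\<Sum>v\<in>parcs G `` {u}. f v / d u)"
    by (rule sum_nbrs_eq[symmetric])
  finally show ?thesis by (simp add: sum_divide_distrib)
qed

text \<open>
  Because adjacency is symmetric, \<open>w\<close> is stationary iff \<open>w u / deg u\<close> is harmonic, hence constant.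
\<close>

lemma stationary_eq:
  assumes n: "card (pverts G) > 1"
  shows "stationary G = (\<lambda>u. if u \<in> pverts G then d u / vol else 0)"
proof -
  have sum_in: "(\<Sum>i\<in>pverts G. w i * transition G i j) = (\<Sum>i\<in>parcs G `` {j}. w i / d i)"
    for w j
  proof -
    have "(\<Sum>i\<in>pverts G. w i * transition G i j) = (\<Sum>i\<in>pverts G. if (j, i) \<in> parcs G then w i / d i else 0)"
      by (intro sum.cong) (auto simp: transition_def adjacency_def intro: arcs_sym)
    also have "\<dots> = (\<Sum>i\<in>parcs G `` {j}. w i / d i)"
      by (rule sum_nbrs_eq[symmetric])
    finally show ?thesis .
  qed
  note pos = deg_pos[OF n] and vpos = vol_pos[OF n]
  show ?thesis unfolding stationary_def
  proof (rule the_equality, intro conjI ballI allI impI)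
    show "(\<Sum>j\<in>pverts G. if j \<in> pverts G then d j / vol else 0) = 1"
      using vpos by (simp add: sum_divide_distrib[symmetric] vol_def)
    fix j assume j: "j \<in> pverts G"
    have "(\<Sum>i\<in>parcs G `` {j}. (if i \<in> pverts G then d i / vol else 0) / d i) =
        (\<Sum>i\<in>parcs G `` {j}. 1 / vol)"
      using nbrs_subset[of j] pos by (intro sum.cong) fastforce+
    then show "(\<Sum>i\<in>pverts G. (if i \<in> pverts G then d i / vol else 0) * transition G i j) =
        (if j \<in> pverts G then d j / vol else 0)"
      using j unfolding sum_in by (simp add: deg_eq)
  next
    fix w assume w: "(\<forall>j\<in>pverts G. 0 < w j) \<and> (\<forall>j. j \<notin> pverts G \<longrightarrow> w j = 0) \<and>
      sum w (pverts G) = 1 \<and> (\<forall>j\<in>pverts G. (\<Sum>i\<in>pverts G. w i * transition G i j) = w j)"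
    have "laplacian G (\<lambda>v. w v / d v) u = 0" if "u \<in> pverts G" for u
      using w pos[OF that] that by (simp add: laplacian_alt sum_in)
    then have const: "w x / d x = w y / d y" if "x \<in> pverts G" "y \<in> pverts G" for x y
      using that by (rule harmonic_imp_constant)
    have "w x = d x / vol" if x: "x \<in> pverts G" for x
    proof -
      have "1 = (\<Sum>y\<in>pverts G. w x / d x * d y)"
        using w const[OF x] pos by (auto intro!: sum.cong elim!: trans[OF sym])
      also have "\<dots> = w x / d x * vol"
        by (simp add: vol_def sum_distrib_left)
      finally show ?thesis
        using vpos pos[OF x] by (simp add: field_simps)
    qed
    then show "w = (\<lambda>u. if u \<in> pverts G then d u / vol else 0)"
      using w by auto
  qed (use pos vpos in auto)
qed

text \<open>
  The expected hitting time of \<open>j\<close> from \<open>i\<close>. The summand \<open>(D i j + D j z - D i z) / 2\<close> is the length of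
  the common part of the paths from \<open>j\<close> to \<open>i\<close> and from \<open>j\<close> to \<open>z\<close> (a Gromov product), and \<open>d z\<close>
  times it is the expected time spent at \<open>z\<close> before reaching \<open>j\<close>.
\<close>

definition hit :: "'a \<Rightarrow> 'a \<Rightarrow> real" where
  "hit i j = (\<Sum>z\<in>pverts G. d z * (D i j + D j z - D i z)) / 2"

lemma hit_self: "j \<in> pverts G \<Longrightarrow> hit j j = 0"
  by (simp add: hit_def D_self)

text \<open>
  The identity for \<open>D\<close> makes the terms \<open>d i - 2\<close> cancel. Away from \<open>j\<close> one obtains the first-step
  equation of hitting times; the value at \<open>j\<close> encodes the mean return time \<open>vol / d j\<close>.
\<close>

lemma laplacian_hit:
  assumes i: "i \<in> pverts G" and j: "j \<in> pverts G"
  shows "laplacian G (\<lambda>i. hit i j) i = (if i = j then vol else 0) - d i"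
proof -
  have "laplacian G (\<lambda>i. hit i j) i =
      (\<Sum>v\<in>parcs G `` {i}. \<Sum>z\<in>pverts G. d z * ((D v j - D i j) - (D v z - D i z))) / 2"
    unfolding laplacian_def hit_def diff_divide_distrib[symmetric] sum_subtractf[symmetric]
      sum_divide_distrib[symmetric]
    by (simp add: algebra_simps)
  also have "\<dots> = (\<Sum>z\<in>pverts G. d z * (laplacian G (\<lambda>v. D v j) i - laplacian G (\<lambda>v. D v z) i)) / 2"
    by (subst sum.swap) (simp add: laplacian_def sum_subtractf[symmetric] sum_distrib_left)
  also have "\<dots> = (\<Sum>z\<in>pverts G. (if i = j then d z else 0) - (if i = z then d z else 0))"
    unfolding sum_divide_distrib using i j
    by (intro sum.cong) (auto simp: laplacian_D)
  also have "\<dots> = (if i = j then vol else 0) - d i"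
    using finite_verts i by (simp add: sum_subtractf vol_def)
  finally show ?thesis .
qed

definition passage :: "'a \<Rightarrow> 'a \<Rightarrow> real" where
  "passage i j = hit i j + (if i = j then vol / d j else 0)"

text \<open>
  The probability that the walk from \<open>i\<close> avoids \<open>j\<close> at the times \<open>1, \<dots>, s\<close>, by first-step analysis.
\<close>

primrec survival :: "'a \<Rightarrow> nat \<Rightarrow> 'a \<Rightarrow> real" where
  "survival j 0 i = 1"
| "survival j (Suc s) i = (\<Sum>v\<in>parcs G `` {i}. if v = j then 0 else survival j s v) / d i"

lemma survival_nonneg: "survival j s i \<ge> 0"
  by (induction s arbitrary: i) (auto intro!: sum_nonneg divide_nonneg_nonneg)

lemma hit_nonneg:
  assumes "i \<in> pverts G" "j \<in> pverts G" shows "hit i j \<ge> 0"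
  using assms D_triangle[of i j]
  by (auto simp: hit_def intro!: sum_nonneg mult_nonneg_nonneg)

context
  assumes nontrivial: "card (pverts G) > 1"
begin

lemma passage_eq:
  assumes "i \<in> pverts G" "j \<in> pverts G"
  shows "passage i j = 1 + (\<Sum>v\<in>parcs G `` {i}. hit v j) / d i"
proof -
  have "(\<Sum>v\<in>parcs G `` {i}. hit v j) = d i * hit i j + (if i = j then vol else 0) - d i"
    using laplacian_hit[OF assms] by (simp add: laplacian_alt)
  then show ?thesis
    using deg_pos[OF nontrivial assms(1)] by (cases "i = j") (simp_all add: passage_def field_simps)
qed

lemma survival_partial_sum_Suc:
  "(\<Sum>s<Suc N. survival j s i) =
    1 + (\<Sum>v\<in>parcs G `` {i}. if v = j then 0 else \<Sum>s<N. survival j s v) / d i"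
proof -
  have "(\<Sum>s<Suc N. survival j s i) = 1 + (\<Sum>s<N. survival j (Suc s) i)"
    by (subst sum.lessThan_Suc_shift) simp
  also have "(\<Sum>s<N. survival j (Suc s) i) =
      (\<Sum>v\<in>parcs G `` {i}. \<Sum>s<N. if v = j then 0 else survival j s v) / d i"
    by (subst sum.swap) (simp add: sum_divide_distrib)
  also have "\<dots> = (\<Sum>v\<in>parcs G `` {i}. if v = j then 0 else \<Sum>s<N. survival j s v) / d i"
    by (intro arg_cong2[where f = "(/)"] sum.cong) auto
  finally show ?thesis .
qed

text \<open>
  The candidate solution bounds every truncated expectation. This gives convergence, so that the
  first-step equation may be solved among real-valued functions.
\<close>

lemma survival_partial_sum_le:
  assumes "i \<in> pverts G" "j \<in> pverts G"
  shows "(\<Sum>s<N. survival j s i) \<le> passage i j"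
  using assms(1)
proof (induction N arbitrary: i)
  case 0
  then show ?case
    using hit_nonneg[OF 0 assms(2)] deg_pos[OF nontrivial assms(2)] vol_pos[OF nontrivial]
    by (simp add: passage_def)
next
  case (Suc N)
  have "(\<Sum>v\<in>parcs G `` {i}. if v = j then 0 else \<Sum>s<N. survival j s v) \<le>
      (\<Sum>v\<in>parcs G `` {i}. hit v j)"
  proof (rule sum_mono)
    fix v assume "v \<in> parcs G `` {i}"
    then have "v \<in> pverts G" using nbrs_subset by blast
    then show "(if v = j then 0 else \<Sum>s<N. survival j s v) \<le> hit v j"
      using Suc.IH[of v] hit_self by (auto simp: passage_def)
  qed
  then show ?case
    unfolding survival_partial_sum_Suc passage_eq[OF Suc.prems assms(2)]
    by (simp add: divide_right_mono)
qed

text \<open>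
  The true and the conjectured hitting times satisfy the same equation off \<open>j\<close>, so their difference
  is harmonic off \<open>j\<close>. A Laplacian has sum zero, hence the difference is harmonic at \<open>j\<close> as well; it is
  constant and vanishes at \<open>j\<close>.
\<close>

lemma survival_sums_passage:
  assumes i: "i \<in> pverts G" and j: "j \<in> pverts G"
  shows "(\<lambda>s. survival j s i) sums passage i j"
proof -
  have summable: "summable (\<lambda>s. survival j s v)" if "v \<in> pverts G" for v
    using survival_nonneg survival_partial_sum_le[OF that j] by (rule summableI_nonneg_bounded)
  define S where "S v = (\<Sum>s. survival j s v)" for v
  \<comment> \<open>\<open>S\<close> counts from time \<open>1\<close> on, so \<open>S j\<close> is a return time; \<open>h\<close> is the hitting time proper.\<close>
  define h where "h v = (if v = j then 0 else S v)" for v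
  have lim: "(\<lambda>N. \<Sum>s<N. survival j s v) \<longlonglongrightarrow> S v" if "v \<in> pverts G" for v
    using summable_LIMSEQ[OF summable[OF that]] by (simp add: S_def)
  have S_eq: "S u = 1 + (\<Sum>v\<in>parcs G `` {u}. h v) / d u" if u: "u \<in> pverts G" for u
  proof (rule LIMSEQ_unique)
    show "(\<lambda>N. \<Sum>s<Suc N. survival j s u) \<longlonglongrightarrow> S u"
      using lim[OF u] by (rule LIMSEQ_Suc)
    have "(\<lambda>N. if v = j then 0 else \<Sum>s<N. survival j s v) \<longlonglongrightarrow> h v"
      if "v \<in> parcs G `` {u}" for v
      using lim[of v] that nbrs_subset by (auto simp: h_def)
    then show "(\<lambda>N. \<Sum>s<Suc N. survival j s u) \<longlonglongrightarrow> 1 + (\<Sum>v\<in>parcs G `` {u}. h v) / d u"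
      unfolding survival_partial_sum_Suc using deg_pos[OF nontrivial u]
      by (intro tendsto_intros) auto
  qed
  define g where "g v = h v - hit v j" for v
  have lap_g: "laplacian G g u = laplacian G h u - laplacian G (\<lambda>v. hit v j) u" for u
    by (simp add: g_def laplacian_def sum_subtractf[symmetric] algebra_simps)
  have lap_0: "laplacian G g u = 0" if u: "u \<in> pverts G" "u \<noteq> j" for u
  proof -
    have "laplacian G h u = - d u"
      using S_eq[OF u(1)] deg_pos[OF nontrivial u(1)] u(2)
      by (simp add: laplacian_alt h_def[of u] field_simps)
    then show ?thesis using laplacian_hit[OF u(1) j] u(2) by (simp add: lap_g)
  qed
  have "(\<Sum>u\<in>pverts G. if u = j then laplacian G g j else 0) = (\<Sum>u\<in>pverts G. laplacian G g u)"
    by (intro sum.cong) (auto simp: lap_0)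
  also have "\<dots> = 0"
    by (rule sum_laplacian)
  finally have "laplacian G g j = 0"
    using finite_verts j by simp
  with lap_0 have "laplacian G g u = 0" if "u \<in> pverts G" for u
    using that by (cases "u = j") auto
  then have "g v = g j" if "v \<in> pverts G" for v
    using that j by (rule harmonic_imp_constant)
  then have "h v = hit v j" if "v \<in> pverts G" for v
    using that hit_self[OF j] by (simp add: g_def h_def[of j])
  then have "(\<Sum>v\<in>parcs G `` {i}. h v) = (\<Sum>v\<in>parcs G `` {i}. hit v j)"
    using nbrs_subset[of i] by (intro sum.cong) auto
  then have "S i = passage i j"
    using S_eq[OF i] passage_eq[OF i j] by simp
  then show ?thesis
    using summable_sums[OF summable[OF i]] by (simp add: S_def)
qed

lemma transition_nonneg: "transition G i x \<ge> 0"
  by (simp add: transition_def adjacency_def)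

lemma transition_outside: "x \<notin> pverts G \<Longrightarrow> transition G i x = 0"
  using arcs_in_verts by (auto simp: transition_def adjacency_def)

lemma pmf_transition:
  assumes "i \<in> pverts G"
  shows "pmf (embed_pmf (transition G i)) v = transition G i v"
proof (rule pmf_embed_pmf)
  show "0 \<le> transition G i x" for x
    by (rule transition_nonneg)
  have "(\<integral>\<^sup>+x. ennreal (transition G i x) \<partial>count_space UNIV) =
      (\<Sum>x\<in>pverts G. ennreal (transition G i x))"
    using finite_verts transition_outside by (intro nn_integral_count_space') auto
  also have "\<dots> = ennreal (\<Sum>x\<in>pverts G. transition G i x)"
    by (intro sum_ennreal transition_nonneg)
  also have "(\<Sum>x\<in>pverts G. transition G i x) = 1"
    using sum_transition[of i "\<lambda>_. 1"] deg_pos[OF nontrivial assms] by (simp add: deg_eq)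
  finally show "(\<integral>\<^sup>+x. ennreal (transition G i x) \<partial>count_space UNIV) = 1" by simp
qed

lemma taboo_step_eq:
  assumes i: "i \<in> pverts G"
    and g: "\<And>v. v \<in> pverts G \<Longrightarrow> g v = ennreal (f v)" "\<And>v. f v \<ge> 0"
  shows "taboo_step G j g i = ennreal ((\<Sum>v\<in>parcs G `` {i}. if v = j then 0 else f v) / d i)"
proof -
  have "taboo_step G j g i =
      (\<integral>\<^sup>+v. ennreal (transition G i v) * (if v = j then 0 else g v) \<partial>count_space UNIV)"
    by (simp add: taboo_step_def nn_integral_measure_pmf pmf_transition[OF i])
  also have "\<dots> = (\<Sum>v\<in>pverts G. ennreal (transition G i v) * (if v = j then 0 else g v))"
    using finite_verts transition_outside by (intro nn_integral_count_space') auto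
  also have "\<dots> = (\<Sum>v\<in>pverts G. ennreal (transition G i v * (if v = j then 0 else f v)))"
    using g by (intro sum.cong) (auto simp: ennreal_mult[symmetric] transition_nonneg)
  also have "\<dots> = ennreal (\<Sum>v\<in>pverts G. transition G i v * (if v = j then 0 else f v))"
    using g by (intro sum_ennreal) (auto simp: transition_nonneg)
  finally show ?thesis unfolding sum_transition .
qed

lemma taboo_step_power:
  "i \<in> pverts G \<Longrightarrow> (taboo_step G j ^^ s) (\<lambda>_. 1) i = ennreal (survival j s i)"
proof (induction s arbitrary: i)
  case (Suc s)
  then show ?case
    using taboo_step_eq[OF Suc.prems Suc.IH survival_nonneg] by simp
qed simp

lemma mean_passage_time_eq:
  assumes "i \<in> pverts G" "j \<in> pverts G"
  shows "mean_passage_time G i j = passage i j"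
proof -
  have "(\<integral>\<^sup>+\<omega>. passage_time j \<omega> \<partial>random_walk G i) = (\<Sum>s. ennreal (survival j s i))"
    unfolding nn_integral_passage_time using assms by (simp add: taboo_step_power)
  also have "\<dots> = ennreal (passage i j)"
    using survival_nonneg survival_sums_passage[OF assms] by (intro suminf_ennreal_eq)
  finally have "mean_passage_time G i j = enn2real (ennreal (passage i j))"
    by (simp only: mean_passage_time_def)
  moreover have "passage i j \<ge> 0"
    using hit_nonneg[OF assms] vol_pos[OF nontrivial] by (simp add: passage_def)
  ultimately show ?thesis by simp
qed

end

text \<open>
  In \<open>\<Sum>j. hit i j * d j\<close> the two terms that
  contain the starting vertex \<open>i\<close> cancel by symmetry; this is also why the defining sum does not
  depend on \<open>i\<close>. Multiplying by \<open>vol\<close> includes the single vertex, where both sides vanish.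
\<close>

lemma kemeny_eq:
  assumes "pverts G \<noteq> {}"
  shows "2 * vol * kemeny G = (\<Sum>j\<in>pverts G. \<Sum>z\<in>pverts G. d j * d z * D j z)"
proof (cases "card (pverts G) = 1")
  case True
  then obtain u where u: "pverts G = {u}" by (auto simp: card_1_singleton_iff)
  then have "vol = 0" using vol_eq[OF assms] by simp
  then show ?thesis using u D_self by simp
next
  case False
  with assms finite_verts have n: "card (pverts G) > 1"
    by (simp add: nat_neq_iff card_gt_0_iff)
  note vpos = vol_pos[OF n]
  let ?W = "\<Sum>j\<in>pverts G. \<Sum>z\<in>pverts G. d j * d z * D j z"
  have "(\<Sum>j\<in>pverts G. mean_passage_time G i j * stationary G j) - 1 = ?W / (2 * vol)"
    if i: "i \<in> pverts G" for i
  proof -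
    have "(\<Sum>j\<in>pverts G. mean_passage_time G i j * stationary G j) =
        (\<Sum>j\<in>pverts G. hit i j * d j / vol + (if i = j then 1 else 0))"
      using deg_pos[OF n] vpos
      by (intro sum.cong)
         (auto simp: mean_passage_time_eq[OF n i] stationary_eq[OF n] passage_def field_simps)
    also have "\<dots> = (\<Sum>j\<in>pverts G. hit i j * d j) / vol + 1"
      using i finite_verts by (simp add: sum.distrib sum_divide_distrib)
    also have "(\<Sum>j\<in>pverts G. hit i j * d j) =
        (\<Sum>j\<in>pverts G. \<Sum>z\<in>pverts G. d j * d z * D i j + d j * d z * D j z - d j * d z * D i z) / 2"
      by (simp add: hit_def sum_divide_distrib sum_distrib_left sum_distrib_right algebra_simps)
    also have "\<dots> = ?W / 2"
      using sum.swap[of "\<lambda>j z. d j * d z * D i j" "pverts G" "pverts G"]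
      by (simp add: sum.distrib sum_subtractf mult.commute[of "d _" "d _"])
    finally show ?thesis by simp
  qed
  moreover obtain i where "i \<in> pverts G" using assms by auto
  ultimately have "kemeny G = ?W / (2 * vol)"
    unfolding kemeny_def using False by (auto intro!: the_equality)
  then show ?thesis using vpos by simp
qed

end

section \<open>Distances in trees\<close>

locale undirected_tree = pair_graph +
  assumes is_connected: "Digraph_Component.connected (with_proj G)"
    and no_cycle: "cycle p \<Longrightarrow> length p < 3"
begin

lemma ex_awalk:
  assumes "u \<in> pverts G" "v \<in> pverts G"
  shows "\<exists>p. awalk u p v"
proof -
  have "reachable (with_proj (mk_symmetric G)) u v"
    using is_connected assms by (auto simp: connected_def strongly_connected_def)
  then have "reachable (with_proj G) u v"
    using reachable_mk_symmetric_eq[OF sym_arcs] by simp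
  then show ?thesis by (simp add: reachable_awalk)
qed

lemma gdist_le: "awalk u p v \<Longrightarrow> gdist G u v \<le> length p"
  unfolding gdist_def by (rule Least_le) auto

lemma shortest_awalk:
  assumes "u \<in> pverts G" "v \<in> pverts G"
  obtains p where "awalk u p v" "length p = gdist G u v"
proof -
  have "\<exists>p. awalk u p v \<and> length p = gdist G u v"
    unfolding gdist_def using ex_awalk[OF assms]
    by (intro LeastI_ex[of "\<lambda>l. \<exists>p. awalk u p v \<and> length p = l"]) blast
  then show ?thesis using that by blast
qed

lemma gdist_self: "u \<in> pverts G \<Longrightarrow> gdist G u u = 0"
  using gdist_le[of u "[]" u] by (simp add: awalk_Nil_iff)

lemma gdist_eq_0:
  assumes "u \<in> pverts G" "v \<in> pverts G" "gdist G u v = 0"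
  shows "u = v"
proof -
  obtain p where "awalk u p v" "length p = gdist G u v"
    using shortest_awalk assms by blast
  with assms(3) show ?thesis by (simp add: awalk_Nil_iff)
qed

lemma length_rev_path: "length (rev_path p) = length p"
  by (induction p) auto

lemma gdist_commute:
  assumes "u \<in> pverts G" "v \<in> pverts G"
  shows "gdist G u v = gdist G v u"
proof -
  have "gdist G u v \<le> gdist G v u" if uv: "u \<in> pverts G" "v \<in> pverts G" for u v
  proof -
    obtain p where p: "awalk v p u" "length p = gdist G v u"
      using shortest_awalk uv by blast
    then have "awalk u (rev_path p) v" by simp
    from gdist_le[OF this] show ?thesis by (simp add: length_rev_path p(2))
  qed
  then show ?thesis using assms by (intro antisym)
qed

lemma gdist_triangle:
  assumes "u \<in> pverts G" "v \<in> pverts G" "w \<in> pverts G"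
  shows "gdist G u w \<le> gdist G u v + gdist G v w"
proof -
  obtain p where p: "awalk u p v" "length p = gdist G u v"
    using shortest_awalk assms by blast
  obtain q where q: "awalk v q w" "length q = gdist G v w"
    using shortest_awalk assms by blast
  show ?thesis
    using gdist_le[OF awalk_appendI[OF p(1) q(1)]] p q by simp
qed

lemma gdist_arc:
  assumes "(u, v) \<in> parcs G"
  shows "gdist G u v = 1"
proof -
  have uv: "u \<in> pverts G" "v \<in> pverts G" "u \<noteq> v"
    using assms wellformed' no_loops' by auto
  have "gdist G u v \<le> 1"
    using gdist_le[of u "[(u, v)]" v] assms uv by (simp add: awalk_simps)
  moreover have "gdist G u v \<noteq> 0"
    using gdist_eq_0 uv by blast
  ultimately show ?thesis by simp
qed

text \<open>
  Otherwise a path from \<open>a\<close> to \<open>b\<close> that avoids \<open>i\<close> closes up through \<open>i\<close> to a cycle of length at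
  least \<open>3\<close>.
\<close>

lemma awalk_avoiding_imp_eq:
  assumes arcs: "(i, a) \<in> parcs G" "(i, b) \<in> parcs G"
    and p: "awalk a p b" "i \<notin> set (awalk_verts a p)"
  shows "a = b"
proof (rule ccontr)
  assume "a \<noteq> b"
  define q where "q = awalk_to_apath p"
  have q: "awalk a q b" "distinct (awalk_verts a q)"
    using apath_awalk_to_apath[OF p(1)] by (auto simp: q_def apath_def)
  have "set q \<subseteq> set p"
    using awalk_to_apath_subset[OF p(1)] by (simp add: q_def)
  then have "i \<notin> set (awalk_verts a q)"
    using p(2) unfolding set_awalk_verts[OF q(1)] set_awalk_verts[OF p(1)] by auto
  moreover have "q \<noteq> []"
    using q(1) \<open>a \<noteq> b\<close> by (auto simp: awalk_Nil_iff)
  moreover have walk: "awalk a (q @ [(b, i)]) i"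
    using arcs_symmetric[OF arcs(2)] in_arcsD1[OF arcs(1)]
    by (intro awalk_appendI[OF q(1)]) (simp add: awalk_simps)
  then have "awalk i ((i, a) # q @ [(b, i)]) i"
    using arcs(1) by (simp add: awalk_Cons_iff del: awalk_append_iff)
  moreover have "awalk_verts a (q @ [(b, i)]) = awalk_verts a q @ [i]"
    using awalk_verts_append[OF walk] by simp
  ultimately have "cycle ((i, a) # q @ [(b, i)])"
    using q(2) unfolding cycle_def by (intro exI[of _ i]) simp
  from no_cycle[OF this] have "length q = 0" by simp
  with \<open>q \<noteq> []\<close> show False by simp
qed

lemma shortest_awalk_avoids:
  assumes p: "awalk a p z" "length p = gdist G a z"
    and i: "i \<noteq> a" "gdist G a z \<le> gdist G i z"
  shows "i \<notin> set (awalk_verts a p)"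
proof
  assume "i \<in> set (awalk_verts a p)"
  then obtain q r where qr: "p = q @ r" "awalk a q i" "awalk i r z"
    using awalk_decomp[OF p(1)] by blast
  with i(1) have "q \<noteq> []" by (auto simp: awalk_Nil_iff)
  then have "length r < length p" using qr(1) by simp
  with gdist_le[OF qr(3)] p(2) i(2) show False by simp
qed

text \<open>
  If neither \<open>a\<close> nor \<open>b\<close> is farther from \<open>z\<close> than \<open>i\<close>, then shortest walks from \<open>a\<close> and from \<open>b\<close> to \<open>z\<close>
  avoid \<open>i\<close>, and together they join \<open>a\<close> to \<open>b\<close>. Allowing equality in the hypotheses excludes
  neighbours at the same distance and a second closer neighbour at once.
\<close>

lemma closer_nbr_unique:
  assumes arcs: "(i, a) \<in> parcs G" "(i, b) \<in> parcs G" and z: "z \<in> pverts G"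
    and le: "gdist G a z \<le> gdist G i z" "gdist G b z \<le> gdist G i z"
  shows "a = b"
proof -
  have verts: "a \<in> pverts G" "b \<in> pverts G" and neq: "i \<noteq> a" "i \<noteq> b"
    using arcs wellformed' no_loops' by auto
  obtain p where p: "awalk a p z" "length p = gdist G a z"
    using shortest_awalk verts z by blast
  obtain q where q: "awalk b q z" "length q = gdist G b z"
    using shortest_awalk verts z by blast
  have pq: "awalk a (p @ rev_path q) b"
    by (rule awalk_appendI[OF p(1)]) (simp add: q(1))
  have "i \<notin> set (awalk_verts a (p @ rev_path q))"
    using shortest_awalk_avoids[OF p neq(1) le(1)] shortest_awalk_avoids[OF q neq(2) le(2)]
    by (simp add: set_awalk_verts_append[OF p(1), of "rev_path q" b] q(1) awalk_verts_rev_path[OF q(1)])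
  then show ?thesis
    using awalk_avoiding_imp_eq arcs pq by blast
qed

lemma ex_closer_nbr:
  assumes "i \<in> pverts G" "z \<in> pverts G" "i \<noteq> z"
  obtains a where "(i, a) \<in> parcs G" "gdist G i z = Suc (gdist G a z)"
proof -
  obtain p where p: "awalk i p z" "length p = gdist G i z"
    using shortest_awalk assms by blast
  with assms(3) obtain a q where pq: "p = (i, a) # q" "(i, a) \<in> parcs G" "awalk a q z"
    by (cases p) (auto simp: awalk_simps)
  have "gdist G i z \<le> gdist G i a + gdist G a z"
    using gdist_triangle assms pq(2) wellformed' by blast
  then have "gdist G i z = Suc (gdist G a z)"
    using gdist_le[OF pq(3)] p(2) pq(1) gdist_arc[OF pq(2)] by simp
  then show ?thesis using that pq(2) by blast
qed

lemma laplacian_gdist: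
  assumes u: "u \<in> pverts G" and z: "z \<in> pverts G"
  shows "laplacian G (\<lambda>v. real (gdist G v z)) u = real (deg G u) - 2 + (if u = z then 2 else 0)"
proof (cases "u = z")
  case True
  have "gdist G v z = 1" if "v \<in> parcs G `` {u}" for v
    using that True gdist_arc arcs_symmetric by auto
  then show ?thesis
    using True by (simp add: laplacian_def deg_eq gdist_self[OF z])
next
  case False
  have fin: "finite (parcs G `` {u})"
    using pair_finite_verts wellformed' by (auto intro: finite_subset)
  obtain a where a: "(u, a) \<in> parcs G" "gdist G u z = Suc (gdist G a z)"
    using ex_closer_nbr u z False by blast
  have "real (gdist G v z) - real (gdist G u z) = 1" if v: "(u, v) \<in> parcs G" "v \<noteq> a" for v
  proof -
    have "gdist G u z < gdist G v z"
      using closer_nbr_unique[OF v(1) a(1) z] v(2) a(2) by force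
    moreover have "gdist G v z \<le> gdist G v u + gdist G u z"
      using gdist_triangle u z v(1) wellformed' by blast
    ultimately show ?thesis
      using gdist_arc[OF arcs_symmetric[OF v(1)]] by simp
  qed
  then have "laplacian G (\<lambda>v. real (gdist G v z)) u =
      (real (gdist G a z) - real (gdist G u z)) + (\<Sum>v\<in>parcs G `` {u} - {a}. 1)"
    unfolding laplacian_def using a(1) fin by (subst sum.remove[of _ a]) auto
  moreover have card_pos: "card (parcs G `` {u}) > 0"
    using a(1) fin by (auto simp: card_gt_0_iff)
  have "(real (gdist G a z) - real (gdist G u z)) + (\<Sum>v\<in>parcs G `` {u} - {a}. 1) = real (deg G u) - 2"
    using a card_pos by (simp add: deg_eq card_Diff_singleton of_nat_diff Suc_leI)
  ultimately show ?thesis using False by simp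
qed

lemma tree_metric_gdist: "tree_metric G (\<lambda>u v. real (gdist G u v))"
proof
  show "finite (pverts G)" by (rule pair_finite_verts)
  show "parcs G \<subseteq> pverts G \<times> pverts G" using wellformed' by auto
qed (auto simp: gdist_self gdist_commute laplacian_gdist arcs_symmetric
    of_nat_add[symmetric] gdist_triangle simp del: of_nat_add)

text \<open>
  The handshake lemma: the arcs over an edge are its two orientations.
\<close>

lemma sum_deg_eq: "(\<Sum>u\<in>pverts G. deg G u) = 2 * card (edges G)"
proof -
  have "(\<Sum>u\<in>pverts G. deg G u) = card (SIGMA u:pverts G. parcs G `` {u})"
    using pair_finite_verts wellformed' by (subst card_SigmaI) (auto simp: deg_eq intro: finite_subset)
  also have "(SIGMA u:pverts G. parcs G `` {u}) = parcs G"
    using wellformed' by auto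
  also have "card (parcs G) = (\<Sum>a\<in>parcs G. 1)" by simp
  also have "\<dots> = (\<Sum>e\<in>edges G. \<Sum>a\<in>{a\<in>parcs G. (\<lambda>(u, v). {u, v}) a = e}. 1)"
    unfolding edges_def by (rule sum.image_gen[OF pair_finite_arcs])
  also have "\<dots> = (\<Sum>e\<in>edges G. 2)"
  proof (rule sum.cong[OF refl])
    fix e assume "e \<in> edges G"
    then obtain u v where uv: "(u, v) \<in> parcs G" "e = {u, v}" by (auto simp: edges_def)
    then have "{a\<in>parcs G. (\<lambda>(u, v). {u, v}) a = e} = {(u, v), (v, u)}"
      using arcs_symmetric by (auto simp: doubleton_eq_iff)
    moreover have "u \<noteq> v" using uv no_loops' by blast
    ultimately show "(\<Sum>a\<in>{a\<in>parcs G. (\<lambda>(u, v). {u, v}) a = e}. 1) = (2::nat)" by simp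
  qed
  finally show ?thesis by simp
qed

end

lemma graph_tree_imp_undirected_tree: "graph_tree G \<Longrightarrow> undirected_tree G"
  by (auto simp: graph_tree_def undirected_tree_def undirected_tree_axioms_def not_le)

section \<open>The distance of a concatenation\<close>

definition path_nbrs :: "nat \<Rightarrow> nat \<Rightarrow> nat set" where
  "path_nbrs k i = {j. j < k \<and> (j = Suc i \<or> i = Suc j)}"

lemma path_nbrs_eq:
  "i < k \<Longrightarrow> path_nbrs k i =
    (if Suc i < k then {Suc i} else {}) \<union> (if i = 0 then {} else {i - 1})"
  by (auto simp: path_nbrs_def)

text \<open>
  The distance identity on the path \<open>0, \<dots>, k - 1\<close>, away from the target: of the neighbours of \<open>i\<close>,
  one is closer to \<open>l\<close> and the other, if it exists, is farther away.
\<close>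

lemma path_laplacian:
  assumes "i < k" "l < k" "i \<noteq> l"
  shows "(\<Sum>j\<in>path_nbrs k i. \<bar>real j - real l\<bar> - \<bar>real i - real l\<bar>) = real (card (path_nbrs k i)) - 2"
  using assms by (cases "i < l") (auto simp: path_nbrs_eq of_nat_diff)

locale tree_chain =
  fixes k :: nat and T :: "nat \<Rightarrow> 'a pair_pre_digraph" and r :: "nat \<Rightarrow> 'a"
  assumes rooted: "i < k \<Longrightarrow> rooted_tree (T i) (r i)"
begin

abbreviation "C \<equiv> concatenation k T r"
abbreviation "R i u v \<equiv> real (gdist (T i) u v)"
abbreviation "c i \<equiv> real (card (path_nbrs k i))"

lemma undirected_tree: "i < k \<Longrightarrow> undirected_tree (T i)"
  using rooted by (auto simp: rooted_tree_def intro: graph_tree_imp_undirected_tree)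

lemma root_in: "i < k \<Longrightarrow> r i \<in> pverts (T i)"
  using rooted by (auto simp: rooted_tree_def)

lemma part_nonempty: "i < k \<Longrightarrow> pverts (T i) \<noteq> {}"
  using root_in by blast

lemma part_metric: "i < k \<Longrightarrow> tree_metric (T i) (R i)"
  by (intro undirected_tree.tree_metric_gdist undirected_tree)

lemmas R_self = tree_metric.D_self[OF part_metric]
lemmas R_commute = tree_metric.D_commute[OF part_metric]
lemmas R_triangle = tree_metric.D_triangle[OF part_metric]

fun chain_dist :: "nat \<times> 'a \<Rightarrow> nat \<times> 'a \<Rightarrow> real" where
  "chain_dist (i, u) (j, v) =
    (if i = j then R i u v else R i u (r i) + \<bar>real i - real j\<bar> + R j (r j) v)"

lemma pverts_C: "pverts C = (SIGMA i:{..<k}. pverts (T i))"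
  by (simp add: concatenation_def)

lemma finite_part: "i < k \<Longrightarrow> finite (pverts (T i))"
  by (rule tree_metric.finite_verts[OF part_metric])

lemma nbrs_C:
  assumes "i < k"
  shows "parcs C `` {(i, u)} =
    Pair i ` (parcs (T i) `` {u}) \<union> (if u = r i then (\<lambda>j. (j, r j)) ` path_nbrs k i else {})"
  using assms by (auto simp: concatenation_def path_nbrs_def)

lemma sum_nbrs_C:
  fixes f :: "nat \<times> 'a \<Rightarrow> real"
  assumes "i < k"
  shows "(\<Sum>x\<in>parcs C `` {(i, u)}. f x) =
    (\<Sum>v\<in>parcs (T i) `` {u}. f (i, v)) + (if u = r i then \<Sum>j\<in>path_nbrs k i. f (j, r j) else 0)"
proof -
  have fin: "finite (parcs (T i) `` {u})"
    by (rule tree_metric.finite_nbrs[OF part_metric[OF assms]])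
  have fin': "finite (path_nbrs k i)" by (simp add: path_nbrs_def)
  have "(\<Sum>x\<in>parcs C `` {(i, u)}. f x) = (\<Sum>x\<in>Pair i ` (parcs (T i) `` {u}). f x) +
      (\<Sum>x\<in>(if u = r i then (\<lambda>j. (j, r j)) ` path_nbrs k i else {}). f x)"
    unfolding nbrs_C[OF assms] using fin fin'
    by (intro sum.union_disjoint) (auto simp: path_nbrs_def)
  then show ?thesis
    by (simp add: sum.reindex inj_on_def)
qed

lemma deg_C:
  "i < k \<Longrightarrow> real (deg C (i, u)) = real (deg (T i) u) + (if u = r i then c i else 0)"
  using sum_nbrs_C[of i "\<lambda>_. 1" u] by (simp add: deg_eq)

text \<open>
  Only a root \<open>r i\<close> has neighbours outside its own tree. If the target \<open>(l, w)\<close> lies in the same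
  tree, each of the \<open>c i\<close> new neighbours is one step farther away, which adds \<open>c i\<close> on both sides.
  Otherwise \<open>(l, w)\<close> is seen from the \<open>i\<close>-th tree as if it sat behind the root: the tree contributes the
  surplus \<open>2\<close> of a target at \<open>r i\<close>, and the path contributes \<open>c i - 2\<close>.
\<close>

lemma chain_dist_laplacian:
  assumes x: "(i, u) \<in> pverts C" and y: "(l, w) \<in> pverts C"
  shows "laplacian C (\<lambda>v. chain_dist v (l, w)) (i, u) =
    real (deg C (i, u)) - 2 + (if (i, u) = (l, w) then 2 else 0)"
proof -
  from x y have i: "i < k" "u \<in> pverts (T i)" and l: "l < k" "w \<in> pverts (T l)"
    by (auto simp: pverts_C)
  have split: "laplacian C (\<lambda>v. chain_dist v (l, w)) (i, u) =
      laplacian (T i) (\<lambda>v. chain_dist (i, v) (l, w)) u +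
      (if u = r i then \<Sum>j\<in>path_nbrs k i. chain_dist (j, r j) (l, w) - chain_dist (i, u) (l, w) else 0)"
    unfolding laplacian_def by (rule sum_nbrs_C[OF i(1)])
  have to_root: "chain_dist (j, r j) (l, w) = \<bar>real j - real l\<bar> + R l (r l) w" if "j < k" for j
    using that root_in R_self by simp
  have nbr: "j < k" "j \<noteq> i" if "j \<in> path_nbrs k i" for j
    using that by (auto simp: path_nbrs_def)
  show ?thesis
  proof (cases "i = l")
    case True
    have "(\<Sum>j\<in>path_nbrs k i. chain_dist (j, r j) (l, w) - chain_dist (i, r i) (l, w)) =
        (\<Sum>j\<in>path_nbrs k i. 1)"
      using i(1) True by (intro sum.cong) (auto simp: to_root nbr simp del: chain_dist.simps, auto simp: path_nbrs_def)
    then have "(\<Sum>j\<in>path_nbrs k i. chain_dist (j, r j) (l, w) - chain_dist (i, r i) (l, w)) = c i"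
      by simp
    then show ?thesis
      using tree_metric.laplacian_D[OF part_metric[OF i(1)] i(2), of w] True l
      unfolding split deg_C[OF i(1)] by (simp del: of_nat_diff)
  next
    case False
    have "laplacian (T i) (\<lambda>v. chain_dist (i, v) (l, w)) u = laplacian (T i) (\<lambda>v. R i v (r i)) u"
      using False by (simp add: laplacian_def)
    moreover have "(\<Sum>j\<in>path_nbrs k i. chain_dist (j, r j) (l, w) - chain_dist (i, r i) (l, w)) =
        (\<Sum>j\<in>path_nbrs k i. \<bar>real j - real l\<bar> - \<bar>real i - real l\<bar>)"
      using i(1) by (intro sum.cong refl) (simp add: to_root nbr del: chain_dist.simps)
    ultimately show ?thesis
      using tree_metric.laplacian_D[OF part_metric[OF i(1)] i(2) root_in[OF i(1)]]
        path_laplacian[OF i(1) l(1) False] False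
      unfolding split deg_C[OF i(1)] by (simp del: chain_dist.simps)
  qed
qed

lemma tree_metric_chain: "tree_metric C chain_dist"
proof
  show "finite (pverts C)"
    unfolding pverts_C by (intro finite_SigmaI) (auto simp: finite_part)
  show "parcs C \<subseteq> pverts C \<times> pverts C"
    using tree_metric.arcs_in_verts[OF part_metric] root_in
    by (auto simp: concatenation_def)
  show "(y, x) \<in> parcs C" if "(x, y) \<in> parcs C" for x y
    using that by (auto simp: concatenation_def intro: tree_metric.arcs_sym[OF part_metric])
  show "chain_dist x x = 0" if "x \<in> pverts C" for x
    using that R_self by (auto simp: pverts_C)
  show "chain_dist x y = chain_dist y x" if "x \<in> pverts C" "y \<in> pverts C" for x y
    using that R_commute root_in by (auto simp: pverts_C)
  show "chain_dist x z \<le> chain_dist x y + chain_dist y z"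
    if xyz: "x \<in> pverts C" "y \<in> pverts C" "z \<in> pverts C" for x y z
  proof -
    obtain i u j v l w where eq: "x = (i, u)" "y = (j, v)" "z = (l, w)"
      by (metis surj_pair)
    with xyz have in_verts: "i < k" "u \<in> pverts (T i)" "j < k" "v \<in> pverts (T j)"
        "l < k" "w \<in> pverts (T l)"
      by (auto simp: pverts_C)
    \<comment> \<open>One instance for each way in which the trees of the three vertices can coincide.\<close>
    have "R i u w \<le> R i u v + R i v w" if "i = j" "j = l"
      using that in_verts by (intro R_triangle) auto
    moreover have "R i u (r i) \<le> R i u v + R i v (r i)" if "i = j"
      using that in_verts root_in by (intro R_triangle) auto
    moreover have "R l (r l) w \<le> R l (r l) v + R l v w" if "j = l"
      using that in_verts root_in by (intro R_triangle) auto
    moreover have "R i u w \<le> R i u (r i) + R i (r i) w" if "i = l"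
      using that in_verts root_in by (intro R_triangle) auto
    ultimately show ?thesis
      unfolding eq by auto
  qed
  show "laplacian C (\<lambda>v. chain_dist v z) x = real (deg C x) - 2 + (if x = z then 2 else 0)"
    if "x \<in> pverts C" "z \<in> pverts C" for x z
    using chain_dist_laplacian that by (cases x, cases z) blast
qed

text \<open>
  \<open>a i\<close> is the total degree, in the concatenation, of the vertices of the \<open>i\<close>-th tree.
\<close>

abbreviation "m i \<equiv> real (card (edges (T i)))"
abbreviation "\<mu> i \<equiv> real (moment (T i) (r i))"
abbreviation "a i \<equiv> 2 * m i + c i"

lemma vol_part: "i < k \<Longrightarrow> tree_metric.vol (T i) = 2 * m i"
  using undirected_tree.sum_deg_eq[OF undirected_tree]
  by (simp add: tree_metric.vol_def[OF part_metric] of_nat_sum[symmetric] del: of_nat_sum)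

lemma weighted_sum_C:
  assumes "i < k"
  shows "(\<Sum>u\<in>pverts (T i). real (deg C (i, u)) * f u) =
    (\<Sum>u\<in>pverts (T i). real (deg (T i) u) * f u) + c i * f (r i)"
proof -
  have "(\<Sum>u\<in>pverts (T i). real (deg C (i, u)) * f u) =
      (\<Sum>u\<in>pverts (T i). real (deg (T i) u) * f u + (if u = r i then c i * f u else 0))"
    by (intro sum.cong) (auto simp: deg_C[OF assms] algebra_simps)
  then show ?thesis
    using finite_part[OF assms] root_in[OF assms] by (simp add: sum.distrib)
qed

lemma sum_deg_C: "i < k \<Longrightarrow> (\<Sum>u\<in>pverts (T i). real (deg C (i, u))) = a i"
  using weighted_sum_C[of i "\<lambda>_. 1"] vol_part[of i]
  by (simp add: tree_metric.vol_def[OF part_metric])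

lemma sum_deg_dist_root:
  assumes "i < k"
  shows "(\<Sum>u\<in>pverts (T i). real (deg C (i, u)) * R i u (r i)) = \<mu> i"
  using weighted_sum_C[OF assms, of "\<lambda>u. R i u (r i)"] R_self[OF assms root_in[OF assms]]
  by (simp add: moment_def mult.commute)

lemma sum_deg_root_dist:
  assumes "i < k"
  shows "(\<Sum>u\<in>pverts (T i). real (deg C (i, u)) * R i (r i) u) = \<mu> i"
  unfolding sum_deg_dist_root[OF assms, symmetric]
  using R_commute root_in assms by (intro sum.cong) auto

text \<open>
  For \<open>i \<noteq> j\<close> the distance is a sum of three terms and the double sum factors. For \<open>i = j\<close> the extra
  degree \<open>c i\<close> of the root adds \<open>2 * c i * \<mu> i\<close> to \<open>4 * m i * kemeny (T i)\<close>. Writing the off-diagonal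
  expression for all pairs overcounts the diagonal by \<open>2 * a i * \<mu> i\<close>, which leaves the correction
  \<open>2 * c i * \<mu> i - 2 * a i * \<mu> i = - 4 * m i * \<mu> i\<close>.
\<close>

lemma block_sum:
  assumes i: "i < k" and j: "j < k"
  shows "(\<Sum>u\<in>pverts (T i). \<Sum>v\<in>pverts (T j).
      real (deg C (i, u)) * real (deg C (j, v)) * chain_dist (i, u) (j, v)) =
    (if i = j then 4 * m i * kemeny (T i) - 4 * m i * \<mu> i else 0) +
    (\<mu> i * a j + a i * a j * \<bar>real i - real j\<bar> + a i * \<mu> j)"
proof (cases "i = j")
  case True
  let ?V = "pverts (T i)"
  have inner: "(\<Sum>v\<in>?V. real (deg C (i, v)) * R i u v) =
      (\<Sum>v\<in>?V. real (deg (T i) v) * R i u v) + c i * R i u (r i)" for u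
    by (rule weighted_sum_C[OF i])
  have "(\<Sum>u\<in>?V. \<Sum>v\<in>?V. real (deg C (i, u)) * real (deg C (i, v)) * R i u v) =
      (\<Sum>u\<in>?V. real (deg C (i, u)) * (\<Sum>v\<in>?V. real (deg (T i) v) * R i u v)) +
      c i * (\<Sum>u\<in>?V. real (deg C (i, u)) * R i u (r i))"
    by (simp add: mult.assoc sum_distrib_left[symmetric] inner distrib_left sum.distrib
        mult.left_commute[of _ "c i"])
  also have "(\<Sum>u\<in>?V. real (deg C (i, u)) * (\<Sum>v\<in>?V. real (deg (T i) v) * R i u v)) =
      (\<Sum>u\<in>?V. \<Sum>v\<in>?V. real (deg (T i) u) * real (deg (T i) v) * R i u v) +
      c i * (\<Sum>v\<in>?V. real (deg (T i) v) * R i (r i) v)"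
    by (subst weighted_sum_C[OF i]) (simp add: sum_distrib_left mult.assoc)
  also have "(\<Sum>u\<in>?V. \<Sum>v\<in>?V. real (deg (T i) u) * real (deg (T i) v) * R i u v) =
      4 * m i * kemeny (T i)"
    using tree_metric.kemeny_eq[OF part_metric[OF i] part_nonempty[OF i]] vol_part[OF i] by simp
  also have "(\<Sum>v\<in>?V. real (deg (T i) v) * R i (r i) v) = \<mu> i"
    using weighted_sum_C[OF i, of "R i (r i)"] sum_deg_root_dist[OF i] R_self[OF i root_in[OF i]]
    by simp
  also note sum_deg_dist_root[OF i]
  finally show ?thesis
    using True by (simp add: algebra_simps)
next
  case False
  have "(\<Sum>u\<in>pverts (T i). \<Sum>v\<in>pverts (T j).
      real (deg C (i, u)) * real (deg C (j, v)) * chain_dist (i, u) (j, v)) =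
    (\<Sum>u\<in>pverts (T i). \<Sum>v\<in>pverts (T j).
      (real (deg C (i, u)) * R i u (r i)) * real (deg C (j, v)) +
      real (deg C (i, u)) * real (deg C (j, v)) * \<bar>real i - real j\<bar> +
      real (deg C (i, u)) * (real (deg C (j, v)) * R j (r j) v))"
    using False by (intro sum.cong) (auto simp: algebra_simps)
  also have "\<dots> = \<mu> i * a j + a i * a j * \<bar>real i - real j\<bar> + a i * \<mu> j"
    by (simp add: sum.distrib sum_distrib_left[symmetric] sum_distrib_right[symmetric]
        sum_deg_C[OF i] sum_deg_C[OF j] sum_deg_dist_root[OF i] sum_deg_root_dist[OF j])
  finally show ?thesis using False by simp
qed

lemma card_verts_C: "real (card (pverts C)) = (\<Sum>i<k. m i) + real k"
proof -
  have "real (card (pverts (T i))) = m i + 1" if "i < k" for i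
    using tree_metric.vol_eq[OF part_metric[OF that] part_nonempty[OF that]] vol_part[OF that]
    by simp
  then show ?thesis
    using finite_part by (simp add: pverts_C card_SigmaI sum.distrib)
qed

lemma kemeny_C:
  assumes "k \<ge> 1"
  shows "(real (card (pverts C)) - 1) * kemeny C =
    (\<Sum>i<k. m i * kemeny (T i)) - (\<Sum>i<k. m i * \<mu> i) +
    (real (card (pverts C)) - 1) * (\<Sum>i<k. \<mu> i) + (\<Sum>i<k. \<Sum>j<k. a i * a j * \<bar>real i - real j\<bar>) / 4"
proof -
  interpret C: tree_metric C chain_dist by (rule tree_metric_chain)
  have ne: "pverts C \<noteq> {}"
    using assms root_in[of 0] by (auto simp: pverts_C Sigma_empty_iff)
  let ?N = "real (card (pverts C)) - 1"
  have Sigma: "(\<Sum>x\<in>pverts C. f x) = (\<Sum>i<k. \<Sum>u\<in>pverts (T i). f (i, u))" for f :: "_ \<Rightarrow> real"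
    unfolding pverts_C using finite_part by (subst sum.Sigma) auto
  have sum_a: "(\<Sum>i<k. a i) = 2 * ?N"
    using C.vol_eq[OF ne] by (simp add: C.vol_def Sigma sum_deg_C del: of_nat_sum)
  have "4 * ?N * kemeny C = (\<Sum>x\<in>pverts C. \<Sum>y\<in>pverts C. C.d x * C.d y * chain_dist x y)"
    using C.kemeny_eq[OF ne] C.vol_eq[OF ne] by simp
  also have "\<dots> = (\<Sum>i<k. \<Sum>j<k. \<Sum>u\<in>pverts (T i). \<Sum>v\<in>pverts (T j).
      C.d (i, u) * C.d (j, v) * chain_dist (i, u) (j, v))"
    unfolding Sigma by (intro sum.cong refl sum.swap)
  also have "\<dots> = (\<Sum>i<k. \<Sum>j<k. (if i = j then 4 * m i * kemeny (T i) - 4 * m i * \<mu> i else 0) +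
      (\<mu> i * a j + a i * a j * \<bar>real i - real j\<bar> + a i * \<mu> j))"
    by (intro sum.cong refl block_sum) auto
  also have "\<dots> = (4 * (\<Sum>i<k. m i * kemeny (T i)) - 4 * (\<Sum>i<k. m i * \<mu> i)) +
      ((\<Sum>i<k. \<mu> i) * (\<Sum>j<k. a j) + (\<Sum>i<k. \<Sum>j<k. a i * a j * \<bar>real i - real j\<bar>) +
       (\<Sum>i<k. a i) * (\<Sum>j<k. \<mu> j))"
    unfolding sum_product by (simp add: sum.distrib sum_subtractf sum_distrib_left mult.assoc)
  finally have double_sum: "4 * ?N * kemeny C =
      (4 * (\<Sum>i<k. m i * kemeny (T i)) - 4 * (\<Sum>i<k. m i * \<mu> i)) +
      ((\<Sum>i<k. \<mu> i) * (2 * ?N) + (\<Sum>i<k. \<Sum>j<k. a i * a j * \<bar>real i - real j\<bar>) +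
       2 * ?N * (\<Sum>j<k. \<mu> j))"
    unfolding sum_a .
  \<comment> \<open>Stated with variables, so that simplification does not expand the sums.\<close>
  have "N * K = A - B + N * S + Q / 4"
    if "4 * N * K = (4 * A - 4 * B) + (S * (2 * N) + Q + 2 * N * S)" for N K A B S Q :: real
    using that by (simp add: field_simps)
  from this[OF double_sum] show ?thesis .
qed

end

section \<open>Distance sums on a path\<close>

lemma card_path_nbrs:
  assumes "i < k"
  shows "real (card (path_nbrs k i)) = 2 - (if i = 0 then 1 else 0) - (if i = k - 1 then 1 else 0)"
  using assms by (auto simp: path_nbrs_eq)

text \<open>
  Path degrees are \<open>2\<close> up to a defect of \<open>1\<close> at each end. For \<open>k = 1\<close> the two ends coincide and both
  defects fall on the same vertex, as they should.
\<close>

lemma sum_path_deg: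
  assumes "k \<ge> 1"
  shows "(\<Sum>j<k. real (card (path_nbrs k j)) * f j) = 2 * (\<Sum>j<k. f j) - f 0 - f (k - 1)"
proof -
  have "(\<Sum>j<k. real (card (path_nbrs k j)) * f j) =
      (\<Sum>j<k. 2 * f j - (if j = 0 then f j else 0) - (if j = k - 1 then f j else 0))"
    by (intro sum.cong) (auto simp: card_path_nbrs algebra_simps)
  then show ?thesis
    using assms by (simp add: sum_subtractf sum_distrib_left)
qed

lemma path_dist_ends: "i < k \<Longrightarrow> \<bar>real i - real 0\<bar> + \<bar>real i - real (k - 1)\<bar> = real k - 1"
  by (simp add: of_nat_diff)

lemma sum_path_dist_0: "(\<Sum>j<k. \<bar>real 0 - real j\<bar>) = real k * (real k - 1) / 2"
  by (induction k) (simp_all add: field_simps)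

lemma sum_path_dist: "(\<Sum>i<k. \<Sum>j<k. \<bar>real i - real j\<bar>) = (real k ^ 3 - real k) / 3"
proof (induction k)
  case (Suc k)
  have *: "(\<Sum>i<k. \<bar>real k - real i\<bar>) = real k * (real k + 1) / 2"
  proof -
    have "(\<Sum>i<k. \<bar>real k - real i\<bar>) = (\<Sum>i<k. real k - real i)"
      by (intro sum.cong) auto
    then show ?thesis
      using sum_path_dist_0[of k] by (simp add: sum_subtractf field_simps)
  qed
  have "(\<Sum>i<Suc k. \<Sum>j<Suc k. \<bar>real i - real j\<bar>) =
      (\<Sum>i<k. \<Sum>j<k. \<bar>real i - real j\<bar>) + 2 * (\<Sum>i<k. \<bar>real k - real i\<bar>)"
    by (simp add: sum.distrib abs_minus_commute[of _ "real k"])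
  then show ?case
    unfolding Suc.IH * by (simp add: field_simps power3_eq_cube)
qed simp

text \<open>
  Expanding \<open>a\<close> gives a part quadratic in \<open>m\<close>, a part linear in \<open>m\<close>, and a constant. The distances
  from \<open>i\<close> to the two ends of the path add up to \<open>k - 1\<close>, so summing \<open>\<bar>i - j\<bar>\<close> with the path degrees as
  weights yields twice the unweighted sum minus \<open>k - 1\<close>.
\<close>

lemma path_quadratic_form:
  fixes m :: "nat \<Rightarrow> real"
  assumes k: "k \<ge> 1"
  defines "a \<equiv> \<lambda>i. 2 * m i + real (card (path_nbrs k i))"
  shows "(\<Sum>i<k. \<Sum>j<k. a i * a j * \<bar>real i - real j\<bar>) =
    4 * (\<Sum>i<k. m i * (\<Sum>j<k. \<bar>real i - real j\<bar> * (m j + 2))) - 4 * (real k - 1) * (\<Sum>i<k. m i)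
    + 4 * (real k ^ 3 - real k) / 3 - 2 * real k * (real k - 1) - 2 * (real k - 1)\<^sup>2"
proof -
  let ?x = "\<lambda>i j. \<bar>real i - real j\<bar>" and ?c = "\<lambda>i. real (card (path_nbrs k i))"
  define s where "s i = (\<Sum>j<k. ?x i j)" for i
  have cx: "(\<Sum>j<k. ?c j * ?x i j) = 2 * s i - (real k - 1)" if "i < k" for i
    using sum_path_deg[OF k, of "?x i"] path_dist_ends[OF that] by (simp add: s_def)
  have sum_c: "(\<Sum>j<k. ?c j) = 2 * real k - 2"
    using sum_path_deg[OF k, of "\<lambda>_. 1"] by simp
  have s_ends: "s 0 + s (k - 1) = real k * (real k - 1)"
  proof -
    have "s 0 + s (k - 1) = (\<Sum>j<k. real k - 1)"
      unfolding s_def sum.distrib[symmetric]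
      by (intro sum.cong) (auto simp: of_nat_diff)
    then show ?thesis by simp
  qed
  have "(\<Sum>i<k. \<Sum>j<k. ?c i * ?c j * ?x i j) = (\<Sum>i<k. ?c i * (2 * s i - (real k - 1)))"
    by (simp add: mult.assoc sum_distrib_left[symmetric] cx)
  also have "\<dots> = 2 * (\<Sum>i<k. ?c i * s i) - (real k - 1) * (\<Sum>i<k. ?c i)"
    by (simp add: right_diff_distrib sum_subtractf sum_distrib_left ac_simps)
  also have "(\<Sum>i<k. ?c i * s i) = 2 * ((real k ^ 3 - real k) / 3) - real k * (real k - 1)"
    using sum_path_deg[OF k, of s] s_ends sum_path_dist[of k] by (simp add: s_def)
  finally have cXc: "(\<Sum>i<k. \<Sum>j<k. ?c i * ?c j * ?x i j) =
      2 * (2 * ((real k ^ 3 - real k) / 3) - real k * (real k - 1)) - 2 * (real k - 1)\<^sup>2"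
    by (simp add: sum_c power2_eq_square algebra_simps)
  have mXc: "(\<Sum>i<k. \<Sum>j<k. m i * ?c j * ?x i j) =
      2 * (\<Sum>i<k. m i * s i) - (real k - 1) * (\<Sum>i<k. m i)"
  proof -
    have "(\<Sum>i<k. \<Sum>j<k. m i * ?c j * ?x i j) = (\<Sum>i<k. m i * (2 * s i - (real k - 1)))"
      by (simp add: mult.assoc sum_distrib_left[symmetric] cx)
    also have "\<dots> = (\<Sum>i<k. 2 * (m i * s i) - (real k - 1) * m i)"
      by (intro sum.cong) (auto simp: algebra_simps)
    finally show ?thesis by (simp only: sum_subtractf sum_distrib_left)
  qed
  have cXm: "(\<Sum>i<k. \<Sum>j<k. ?c i * m j * ?x i j) = (\<Sum>i<k. \<Sum>j<k. m i * ?c j * ?x i j)"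
    by (subst sum.swap) (simp add: abs_minus_commute mult.commute[of "?c _"])
  have "(\<Sum>i<k. \<Sum>j<k. a i * a j * ?x i j) =
      4 * (\<Sum>i<k. \<Sum>j<k. m i * m j * ?x i j) + 2 * (\<Sum>i<k. \<Sum>j<k. m i * ?c j * ?x i j) +
      2 * (\<Sum>i<k. \<Sum>j<k. ?c i * m j * ?x i j) + (\<Sum>i<k. \<Sum>j<k. ?c i * ?c j * ?x i j)"
    unfolding a_def sum_distrib_left sum.distrib[symmetric]
    by (intro sum.cong refl) (simp add: algebra_simps)
  moreover have "(\<Sum>i<k. m i * (\<Sum>j<k. ?x i j * (m j + 2))) =
      (\<Sum>i<k. \<Sum>j<k. m i * m j * ?x i j) + 2 * (\<Sum>i<k. m i * s i)"
    unfolding s_def sum_distrib_left sum.distrib[symmetric]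
    by (intro sum.cong refl) (simp add: algebra_simps)
  ultimately show ?thesis
    unfolding cXm mXc cXc by (simp add: algebra_simps)
qed

section \<open>The formula for the concatenation\<close>

theorem proposition2p2:
  fixes k n :: nat
    and T :: "nat \<Rightarrow> 'a pair_pre_digraph" and r :: "nat \<Rightarrow> 'a"
    and C :: "(nat \<times> 'a) pair_pre_digraph"
    and m \<mu> e :: "real vec" and X :: "real mat"
  assumes "k \<ge> 1"
    and "\<And>i. i < k \<Longrightarrow> rooted_tree (T i) (r i)"
  defines "C \<equiv> concatenation k T r"
  defines "n \<equiv> card (pverts C)"
  defines "m \<equiv> vec k (\<lambda>i. real (card (edges (T i))))"
  defines "\<mu> \<equiv> vec k (\<lambda>i. real (moment (T i) (r i)))"
  defines "X \<equiv> mat k k (\<lambda>(i, j). \<bar>real i - real j\<bar>)"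
  defines "e \<equiv> vec k (\<lambda>_. 1)"
  assumes "n \<noteq> 1"
  shows "kemeny C =
    1 / (real n - 1) *
      ((\<Sum>i<k. m $ i * kemeny (T i))
       + m \<bullet> (X *\<^sub>v (m + 2 \<cdot>\<^sub>v e))
       + (real n - 1) * (\<mu> \<bullet> e) - \<mu> \<bullet> m
       + real k ^ 3 / 3 - real k * real n + real n + real k / 6 - 1 / 2)"
proof -
  interpret tree_chain k T r
    using assms(2) by unfold_locales
  let ?m = "\<lambda>i. real (card (edges (T i)))" and ?\<mu> = "\<lambda>i. real (moment (T i) (r i))"
  have "(\<Sum>i<k. m $ i * kemeny (T i)) = (\<Sum>i<k. ?m i * kemeny (T i))"
    by (simp add: m_def)
  moreover have "m \<bullet> (X *\<^sub>v (m + 2 \<cdot>\<^sub>v e)) = (\<Sum>i<k. ?m i * (\<Sum>j<k. \<bar>real i - real j\<bar> * (?m j + 2)))"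
    by (simp add: m_def X_def e_def scalar_prod_def lessThan_atLeast0)
  moreover have "\<mu> \<bullet> e = (\<Sum>i<k. ?\<mu> i)" "\<mu> \<bullet> m = (\<Sum>i<k. ?m i * ?\<mu> i)"
    by (simp_all add: \<mu>_def e_def m_def scalar_prod_def lessThan_atLeast0 mult.commute)
  moreover have "(\<Sum>i<k. ?m i) = real n - real k"
    using card_verts_C by (simp add: n_def C_def)
  moreover have "real n - 1 \<noteq> 0" using \<open>n \<noteq> 1\<close> by simp
  ultimately show ?thesis
    using kemeny_C[OF assms(1)] path_quadratic_form[OF assms(1), of ?m]
    unfolding C_def[symmetric] n_def[symmetric]
    by (simp add: eq_divide_eq) (simp add: field_simps power2_eq_square power3_eq_cube)
qed

end
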